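(* For integers $n > m > 1$ let $N(n,m) := \max |\{ z \in \mathbb{C} : p(z) + \overline{q(z)} = 0 \}|$, where the maximum is taken over all complex polynomials $p$ of degree $n$ and $q$ of degree $m$. Then $$\limsup_{m \to \infty} \limsup_{n \to \infty} \frac{N(n,m)}{n} = \infty.$$
   Context: Zeros are counted as distinct points of $\mathbb{C}$ (without multiplicity). It is known that for $\deg p = n > m = \deg q$ the function $p + \overline{q}$ has at most $n^2$ zeros, so $N(n,m)$ is a well-defined finite number. In the inner limsup, $m$ is fixed and $n \to \infty$ (with $n > m$). *)

theory Defs
  imports
    Complex_Main
    "HOL-Computational_Algebra.Polynomial"
    "HOL-Library.Extended_Real"
    "HOL-Library.Liminf_Limsup"
begin

definition harmonic_zeros :: "complex poly \<Rightarrow> complex poly \<Rightarrow> complex set" where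
  "harmonic_zeros p q = {z. poly p z + cnj (poly q z) = 0}"

(* For n > m the cardinalities below are bounded by n^2 and all zero sets are finite, so neither
   the value of card on infinite sets nor that of Max on infinite sets plays a role.
   The value for n \<le> m is irrelevant. *)
definition max_zeros :: "nat \<Rightarrow> nat \<Rightarrow> nat" where
  "max_zeros n m = Max {card (harmonic_zeros p q) | p q. degree p = n \<and> degree q = m}"

end

theory Submission
  imports Defs "HOL-Library.Function_Algebras"
begin

text \<open>
  The lower bound comes from a small perturbation of a harmonic function with a whole curve of zeros.
  For \<open>q = (z - 1)^m\<close>, the function \<open>q - cnj q = 2 \<i> Im q\<close> vanishes on the \<open>2m\<close> rays that leave the
  point \<open>1\<close>.  Add \<open>\<epsilon> z^n\<close> with \<open>\<epsilon> > 0\<close> tiny.  On each of the \<open>2n\<close> rays from the origin on which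
  \<open>Re (z^n) = 0\<close> all terms are purely imaginary, and the equation becomes the single real equation
  \<open>\<plusminus> \<epsilon> r^n + 2 Im q = 0\<close> in the radius \<open>r\<close>.  It has a root between any two consecutive sign changes
  of \<open>Im q\<close> along the ray.  A ray in the first quadrant sees \<open>arg (z - 1)\<close> decrease from
  \<open>\<pi>\<close> to at most \<open>\<pi>/2\<close>, so that \<open>Im q\<close> changes sign about \<open>m/2\<close> times on it, and there are about \<open>n/2\<close>
  such rays.  This gives about \<open>n m / 4\<close> zeros (lemma \<open>many_zeros\<close>), so the quotient by \<open>n\<close> is unbounded
  in \<open>m\<close>.

  The maximum over all \<open>p\<close> and \<open>q\<close> dominates this example because the numbers of zeros are uniformly
  bounded (lemma \<open>harmonic_zeros_bound\<close>).  On the zero set, \<open>z^n\<close> is a linear combination of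
  lower powers of \<open>z\<close> and of \<open>cnj z\<close>, and by conjugation so is \<open>(cnj z)^n\<close>.  Therefore the \<open>n^2\<close>
  monomials \<open>z^i (cnj z)^j\<close> with \<open>i, j < n\<close> span all polynomial functions on the zero set.  On a finite
  set of points the polynomials give all functions, so there are at most \<open>n^2\<close> points.
\<close>

section \<open>The number of zeros is at most the square of the degree\<close>

interpretation cfun: vector_space "\<lambda>(c::complex) (f::complex \<Rightarrow> complex) x. c * f x"
  by unfold_locales (auto simp: fun_eq_iff algebra_simps)

lemma sum_fun_apply: "(\<Sum>i\<in>A. f i) x = (\<Sum>i\<in>A. f i x)"
  by (induction A rule: infinite_finite_induct) auto

text \<open>
  Cutting the monomials off outside \<open>F\<close> turns identities that hold only on \<open>F\<close> into equalities of
  functions.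
\<close>

definition mono_on_set :: "complex set \<Rightarrow> nat \<Rightarrow> nat \<Rightarrow> complex \<Rightarrow> complex" where
  "mono_on_set F a b = (\<lambda>z. if z \<in> F then z ^ a * cnj z ^ b else 0)"

lemma leading_power_on_zeros:
  assumes "z \<in> harmonic_zeros p q" "degree p = n" "p \<noteq> 0"
  shows "z ^ n = (\<Sum>i<n. (- coeff p i / lead_coeff p) * z ^ i)
           + (\<Sum>j\<le>degree q. (- cnj (coeff q j) / lead_coeff p) * cnj z ^ j)"
proof -
  have lc: "lead_coeff p \<noteq> 0" using assms(3) by simp
  have "poly p z = (\<Sum>i<n. coeff p i * z ^ i) + lead_coeff p * z ^ n"
    using assms(2) by (simp add: poly_altdef flip: lessThan_Suc_atMost)
  moreover have "cnj (poly q z) = (\<Sum>j\<le>degree q. cnj (coeff q j) * cnj z ^ j)"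
    by (simp add: poly_altdef)
  ultimately have "lead_coeff p * z ^ n
      = - (\<Sum>i<n. coeff p i * z ^ i) - (\<Sum>j\<le>degree q. cnj (coeff q j) * cnj z ^ j)"
    using assms(1) unfolding harmonic_zeros_def mem_Collect_eq
    by (simp only: eq_diff_eq eq_neg_iff_add_eq_0 ac_simps)
  then have "z ^ n = (- (\<Sum>i<n. coeff p i * z ^ i)
      - (\<Sum>j\<le>degree q. cnj (coeff q j) * cnj z ^ j)) / lead_coeff p"
    using lc by (simp add: field_simps)
  then show ?thesis
    by (simp add: diff_divide_distrib sum_divide_distrib sum_negf)
qed

lemma monomial_reduction:
  assumes "F \<subseteq> harmonic_zeros p q" "degree p = n" "p \<noteq> 0"
  shows "mono_on_set F (n + a) b
      = (\<Sum>i<n. (\<lambda>z. (- coeff p i / lead_coeff p) * mono_on_set F (i + a) b z))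
      + (\<Sum>j\<le>degree q. (\<lambda>z. (- cnj (coeff q j) / lead_coeff p) * mono_on_set F a (j + b) z))"
    (is "?L = ?R")
proof
  fix z
  show "?L z = ?R z"
  proof (cases "z \<in> F")
    case True
    then have "z ^ n = (\<Sum>i<n. (- coeff p i / lead_coeff p) * z ^ i)
           + (\<Sum>j\<le>degree q. (- cnj (coeff q j) / lead_coeff p) * cnj z ^ j)"
      using leading_power_on_zeros assms by blast
    then have "z ^ (n + a) * cnj z ^ b = ((\<Sum>i<n. (- coeff p i / lead_coeff p) * z ^ i)
           + (\<Sum>j\<le>degree q. (- cnj (coeff q j) / lead_coeff p) * cnj z ^ j)) * (z ^ a * cnj z ^ b)"
      by (simp only: power_add mult.assoc)
    also have "\<dots> = (\<Sum>i<n. (- coeff p i / lead_coeff p) * (z ^ (i + a) * cnj z ^ b))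
           + (\<Sum>j\<le>degree q. (- cnj (coeff q j) / lead_coeff p) * (z ^ a * cnj z ^ (j + b)))"
      unfolding distrib_right sum_distrib_right by (simp only: power_add mult_ac)
    finally show ?thesis
      using True by (simp add: mono_on_set_def sum_fun_apply)
  qed (simp add: mono_on_set_def sum_fun_apply)
qed

lemma cnj_reduction:
  assumes "F \<subseteq> harmonic_zeros p q" "degree p = n" "p \<noteq> 0"
  shows "mono_on_set F a (n + b)
      = (\<Sum>i<n. (\<lambda>z. cnj (- coeff p i / lead_coeff p) * mono_on_set F a (i + b) z))
      + (\<Sum>j\<le>degree q. (\<lambda>z. cnj (- cnj (coeff q j) / lead_coeff p) * mono_on_set F (j + a) b z))"
    (is "?L = ?R")
proof
  fix z
  have swap: "cnj (mono_on_set F c d z) = mono_on_set F d c z" for c d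
    by (simp add: mono_on_set_def)
  have "?L z = cnj (mono_on_set F (n + b) a z)" by (simp only: swap)
  also have "\<dots> = ?R z"
    unfolding monomial_reduction[OF assms]
    by (simp only: sum_fun_apply plus_fun_apply cnj_sum complex_cnj_mult complex_cnj_add swap)
  finally show "?L z = ?R z" .
qed

text \<open>
  Since \<open>degree q < n\<close>, both reductions strictly lower the total degree, so they can be iterated until
  both exponents are below \<open>n\<close>.
\<close>

lemma monomial_in_span:
  assumes "F \<subseteq> harmonic_zeros p q" "degree p = n" "degree q < n"
  shows "mono_on_set F a b \<in> cfun.span ((\<lambda>(i, j). mono_on_set F i j) ` ({..<n} \<times> {..<n}))"
    (is "_ \<in> cfun.span ?T")
proof (induction "a + b" arbitrary: a b rule: less_induct)
  case less
  have p: "p \<noteq> 0" using assms by auto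
  consider "a < n" "b < n" | a' where "a = n + a'" | b' where "b = n + b'"
    by (metis le_Suc_ex linorder_not_le)
  then show ?case
  proof cases
    case 1
    then show ?thesis by (intro cfun.span_base) auto
  next
    case 2
    show ?thesis
      unfolding 2 monomial_reduction[OF assms(1,2) p] using assms(3)
      by (intro cfun.span_add cfun.span_sum cfun.span_scale less) (auto simp: 2)
  next
    case 3
    show ?thesis
      unfolding 3 cnj_reduction[OF assms(1,2) p] using assms(3)
      by (intro cfun.span_add cfun.span_sum cfun.span_scale less) (auto simp: 3)
  qed
qed

text \<open>
  Lagrange interpolation: with it the indicator functions of the points of \<open>F\<close>, which are linearly
  independent, lie in the span of the monomials.
\<close>

lemma indicator_is_polynomial:
  fixes F :: "complex set"
  assumes "finite F" "a \<in> F"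
  shows "\<exists>P. \<forall>z\<in>F. poly P z = (if z = a then 1 else 0)"
proof -
  define Q where "Q = (\<Prod>b\<in>F - {a}. [:- b, 1:])"
  have Q: "poly Q z = (\<Prod>b\<in>F - {a}. z - b)" for z
    by (simp add: Q_def poly_prod)
  have "poly Q a \<noteq> 0" using assms by (auto simp: Q)
  moreover have "poly Q z = 0" if "z \<in> F" "z \<noteq> a" for z
    using that assms by (auto simp: Q)
  ultimately show ?thesis
    by (intro exI[of _ "smult (1 / poly Q a) Q"]) auto
qed

lemma finite_zeros_bound:
  assumes F: "F \<subseteq> harmonic_zeros p q" "finite F" and "degree p = n" "degree q < n"
  shows "card F \<le> n * n"
proof -
  define T where "T = (\<lambda>(i, j). mono_on_set F i j) ` ({..<n} \<times> {..<n})"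
  define e :: "complex \<Rightarrow> complex \<Rightarrow> complex" where "e = (\<lambda>a z. if z = a then 1 else 0)"
  have inj: "inj_on e F"
    by (auto simp: inj_on_def e_def fun_eq_iff)
  have indep: "\<not> cfun.dependent (e ` F)"
  proof
    assume "cfun.dependent (e ` F)"
    then obtain u a where u: "a \<in> F" "u (e a) \<noteq> 0" "(\<Sum>v\<in>e ` F. (\<lambda>x. u v * v x)) = 0"
      using F(2) by (auto simp: cfun.dependent_finite)
    have "(\<Sum>b\<in>F. u (e b) * e b a) = 0"
      using fun_cong[OF u(3), of a] inj by (simp add: sum_fun_apply sum.reindex)
    moreover have "(\<Sum>b\<in>F. u (e b) * e b a) = (\<Sum>b\<in>F. if b = a then u (e a) else 0)"
      by (intro sum.cong) (auto simp: e_def)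
    ultimately show False using u F(2) by simp
  qed
  have "e ` F \<subseteq> cfun.span T"
  proof
    fix f assume "f \<in> e ` F"
    then obtain a where a: "a \<in> F" "f = e a" by auto
    obtain P where P: "\<forall>z\<in>F. poly P z = (if z = a then 1 else 0)"
      using indicator_is_polynomial[OF F(2) a(1)] by blast
    have "e a = (\<Sum>i\<le>degree P. (\<lambda>z. coeff P i * mono_on_set F i 0 z))"
    proof
      fix z
      show "e a z = (\<Sum>i\<le>degree P. (\<lambda>z. coeff P i * mono_on_set F i 0 z)) z"
        using P a(1) by (cases "z \<in> F") (auto simp: e_def mono_on_set_def sum_fun_apply poly_altdef)
    qed
    also have "\<dots> \<in> cfun.span T"
      unfolding T_def using assms
      by (intro cfun.span_sum cfun.span_scale monomial_in_span) auto
    finally show "f \<in> cfun.span T" by (simp add: a)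
  qed
  moreover have "finite T" by (simp add: T_def)
  ultimately have "card (e ` F) \<le> card T"
    using indep cfun.independent_span_bound by blast
  also have "card T \<le> card ({..<n} \<times> {..<n})"
    unfolding T_def by (intro card_image_le) auto
  finally show ?thesis using inj by (simp add: card_image)
qed

lemma harmonic_zeros_bound:
  assumes "degree p = n" "degree q < n"
  shows "finite (harmonic_zeros p q)" "card (harmonic_zeros p q) \<le> n * n"
proof -
  show fin: "finite (harmonic_zeros p q)"
  proof (rule ccontr)
    assume "infinite (harmonic_zeros p q)"
    then obtain F where "F \<subseteq> harmonic_zeros p q" "finite F" "card F = Suc (n * n)"
      using infinite_arbitrarily_large by metis
    then show False using finite_zeros_bound[of F p q n] assms by simp
  qed
  show "card (harmonic_zeros p q) \<le> n * n"
    using finite_zeros_bound[OF order_refl fin assms] .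
qed

lemma card_le_max_zeros:
  assumes "degree p = n" "degree q = m" "m < n"
  shows "card (harmonic_zeros p q) \<le> max_zeros n m"
  unfolding max_zeros_def
proof (rule Max_ge)
  show "finite {card (harmonic_zeros p q) | p q. degree p = n \<and> degree q = m}"
    by (rule finite_subset[of _ "{..n * n}"]) (use assms(3) in \<open>auto intro: harmonic_zeros_bound\<close>)
qed (use assms in auto)

section \<open>Zeros from sign changes along rays\<close>

definition ray_angle :: "nat \<Rightarrow> nat \<Rightarrow> real" where
  "ray_angle n j = pi * (2 * real j + 1) / (2 * real n)"

lemma cis_odd_half_pi: "cis (pi * real k + pi / 2) = (-1) ^ k * \<i>"
  by (simp add: cis_mult[symmetric] Complex.DeMoivre[symmetric] mult.commute[of pi])

lemma cis_ray_angle_power: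
  assumes "n > 0"
  shows "cis (ray_angle n j) ^ n = (-1) ^ j * \<i>"
proof -
  have "real n * ray_angle n j = pi * real j + pi / 2"
    using assms by (simp add: ray_angle_def field_simps)
  then show ?thesis by (simp add: Complex.DeMoivre cis_odd_half_pi)
qed

lemma ray_angle_bounds:
  assumes "j < n div 2"
  shows "0 < ray_angle n j" "ray_angle n j \<le> pi / 2"
proof -
  have "2 * j + 1 \<le> n" "n > 0" using assms by auto
  then have "2 * real j + 1 \<le> real n" "real n > 0" by linarith+
  moreover from this have "pi * (2 * real j + 1) \<le> pi * real n"
    by (intro mult_left_mono) auto
  ultimately show "0 < ray_angle n j" "ray_angle n j \<le> pi / 2"
    by (auto simp: ray_angle_def divide_le_eq intro!: divide_pos_pos mult_pos_pos)
qed

text \<open>On the rays where \<open>z^n\<close> is imaginary, the complex equation becomes one real equation.\<close>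

lemma harmonic_zero_on_ray:
  fixes \<epsilon> r :: real
  assumes "n > 0" and z: "z = of_real r * cis (ray_angle n j)"
    and "\<epsilon> * r ^ n * (-1) ^ j + 2 * Im (poly q z) = 0"
  shows "z \<in> harmonic_zeros (monom (of_real \<epsilon>) n + q) (- q)"
proof -
  have "z ^ n = of_real (r ^ n * (-1) ^ j) * \<i>"
    using assms(1) by (simp add: z power_mult_distrib cis_ray_angle_power)
  then have "poly (monom (of_real \<epsilon>) n + q) z + cnj (poly (- q) z)
      = of_real (\<epsilon> * r ^ n * (-1) ^ j) * \<i> + (poly q z - cnj (poly q z))"
    by (simp add: poly_monom)
  also have "\<dots> = of_real (\<epsilon> * r ^ n * (-1) ^ j + 2 * Im (poly q z)) * \<i>"
    by (simp add: complex_diff_cnj algebra_simps)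
  finally show ?thesis using assms(3) by (simp add: harmonic_zeros_def)
qed

lemma root_between_opposite_signs:
  fixes f :: "real \<Rightarrow> real"
  assumes "a < b" "continuous_on {a..b} f" "f a * f b < 0"
  obtains x where "a < x" "x < b" "f x = 0"
proof -
  have "\<exists>x. a \<le> x \<and> x \<le> b \<and> f x = 0"
    using assms IVT'[of f a 0 b] IVT2'[of f b 0 a] by (auto simp: mult_less_0_iff)
  then obtain x where "a \<le> x" "x \<le> b" "f x = 0" by auto
  moreover have "x \<noteq> a" "x \<noteq> b" using calculation assms(3) by auto
  ultimately show ?thesis using that[of x] by simp
qed

text \<open>
  The radii \<open>R j l\<close> witness the sign changes of \<open>Im q\<close> along ray \<open>j\<close>.  As only finitely many of them
  matter, one \<open>\<epsilon>\<close> preserves all the signs.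
\<close>

lemma zeros_from_sign_changes:
  fixes q :: "complex poly" and R :: "nat \<Rightarrow> nat \<Rightarrow> real"
  assumes deg: "degree q < n"
    and pos: "\<And>j l. j < n div 2 \<Longrightarrow> l \<le> L \<Longrightarrow> 0 < R j l"
    and mono: "\<And>j l l'. j < n div 2 \<Longrightarrow> l < l' \<Longrightarrow> l' \<le> L \<Longrightarrow> R j l < R j l'"
    and sign: "\<And>j l. j < n div 2 \<Longrightarrow> l < L \<Longrightarrow>
        Im (poly q (of_real (R j l) * cis (ray_angle n j)))
        * Im (poly q (of_real (R j (Suc l)) * cis (ray_angle n j))) < 0"
    and nz: "\<And>j l. j < n div 2 \<Longrightarrow> l \<le> L \<Longrightarrow> Im (poly q (of_real (R j l) * cis (ray_angle n j))) \<noteq> 0"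
  shows "(n div 2) * L \<le> max_zeros n (degree q)"
proof -
  have n: "n > 0" using deg by simp
  define g where "g = (\<lambda>j r. Im (poly q (of_real r * cis (ray_angle n j))))"
  have "\<forall>\<^sub>F \<epsilon> in at_right 0. \<forall>x\<in>{..<n div 2} \<times> {..L}.
          \<epsilon> * R (fst x) (snd x) ^ n < \<bar>2 * g (fst x) (R (fst x) (snd x))\<bar>"
  proof (intro eventually_ball_finite ballI)
    fix x assume x: "x \<in> {..<n div 2} \<times> {..L}"
    have "((\<lambda>\<epsilon>. \<epsilon> * R (fst x) (snd x) ^ n) \<longlongrightarrow> 0 * R (fst x) (snd x) ^ n) (at_right 0)"
      by (intro tendsto_intros)
    then show "\<forall>\<^sub>F \<epsilon> in at_right 0. \<epsilon> * R (fst x) (snd x) ^ n < \<bar>2 * g (fst x) (R (fst x) (snd x))\<bar>"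
      by (rule order_tendstoD) (use x nz in \<open>auto simp: g_def\<close>)
  qed auto
  then have "\<forall>\<^sub>F \<epsilon> in at_right 0. \<epsilon> > 0 \<and> (\<forall>x\<in>{..<n div 2} \<times> {..L}.
          \<epsilon> * R (fst x) (snd x) ^ n < \<bar>2 * g (fst x) (R (fst x) (snd x))\<bar>)"
    using eventually_at_right_less[of "0::real"] by (rule eventually_conj[rotated])
  then obtain \<epsilon> :: real where \<epsilon>: "\<epsilon> > 0"
    and small: "\<And>j l. j < n div 2 \<Longrightarrow> l \<le> L \<Longrightarrow> \<epsilon> * R j l ^ n < \<bar>2 * g j (R j l)\<bar>"
    using eventually_happens[of _ "at_right (0::real)"] by fastforce
  define h where "h = (\<lambda>j r. \<epsilon> * r ^ n * (-1) ^ j + 2 * g j r)"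
  \<comment> \<open>The perturbed function has the sign of the unperturbed one at every sample radius.\<close>
  have hsign: "h j (R j l) * g j (R j l) > 0" if "j < n div 2" "l \<le> L" for j l
  proof -
    have "\<bar>\<epsilon> * R j l ^ n * (-1) ^ j\<bar> < \<bar>2 * g j (R j l)\<bar>"
      using small[OF that] pos[OF that] \<epsilon> by (simp add: abs_mult power_abs)
    then show ?thesis
      by (auto simp: h_def zero_less_mult_iff abs_if split: if_splits)
  qed
  have "\<exists>x. R j l < x \<and> x < R j (Suc l) \<and> h j x = 0" if jl: "j < n div 2" "l < L" for j l
  proof -
    have "h j (R j l) * h j (R j (Suc l)) < 0"
      using hsign[of j l] hsign[of j "Suc l"] sign[OF jl] jl
      by (auto simp: g_def zero_less_mult_iff mult_less_0_iff)
    moreover have "continuous_on {R j l..R j (Suc l)} (h j)"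
      unfolding h_def g_def by (intro continuous_intros)
    ultimately show ?thesis
      using mono[of j l "Suc l"] jl by (metis root_between_opposite_signs Suc_leI lessI)
  qed
  then obtain s where s: "\<And>j l. j < n div 2 \<Longrightarrow> l < L \<Longrightarrow>
      R j l < s j l \<and> s j l < R j (Suc l) \<and> h j (s j l) = 0"
    by metis
  define p where "p = monom (of_real \<epsilon>) n + q"
  have degp: "degree p = n"
    unfolding p_def using \<epsilon> deg by (subst degree_add_eq_left) (auto simp: degree_monom_eq)
  define \<zeta> where "\<zeta> = (\<lambda>(j, l). of_real (s j l) * cis (ray_angle n j))"
  have spos: "s j l > 0" if "j < n div 2" "l < L" for j l
    using s[OF that] pos[of j l] that by fastforce
  have s_less: "s j l < s j l'" if "j < n div 2" "l < l'" "l' < L" for j l l'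
  proof -
    have "s j l < R j (Suc l)" using s that by auto
    also have "R j (Suc l) \<le> R j l'"
      using mono[of j "Suc l" l'] that by (cases "Suc l = l'") auto
    also have "R j l' < s j l'" using s that by auto
    finally show ?thesis .
  qed
  have "inj_on \<zeta> ({..<n div 2} \<times> {..<L})"
  proof (rule inj_onI, clarsimp)
    fix j l j' l'
    assume *: "j < n div 2" "l < L" "j' < n div 2" "l' < L" "\<zeta> (j, l) = \<zeta> (j', l')"
    have "norm (\<zeta> (j, l)) = norm (\<zeta> (j', l'))" using * by simp
    then have s_eq: "s j l = s j' l'"
      using spos[of j l] spos[of j' l'] * by (simp add: \<zeta>_def norm_mult)
    then have "cis (ray_angle n j) = cis (ray_angle n j')"
      using * spos[of j' l'] by (simp add: \<zeta>_def)
    then have "cos (ray_angle n j) = cos (ray_angle n j')"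
      by (simp add: complex_eq_iff)
    moreover have "ray_angle n j \<in> {0..pi}" "ray_angle n j' \<in> {0..pi}"
      using ray_angle_bounds[OF *(1)] ray_angle_bounds[OF *(3)] by auto
    ultimately have "ray_angle n j = ray_angle n j'"
      using cos_inj_pi[of "ray_angle n j" "ray_angle n j'"] by simp
    then have "j = j'" using n by (simp add: ray_angle_def)
    moreover have "l = l'"
      using s_less[of j l l'] s_less[of j l' l] s_eq * \<open>j = j'\<close>
      by (cases l l' rule: linorder_cases) auto
    ultimately show "j = j' \<and> l = l'" by simp
  qed
  then have "(n div 2) * L = card (\<zeta> ` ({..<n div 2} \<times> {..<L}))"
    by (simp add: card_image)
  also have "\<zeta> ` ({..<n div 2} \<times> {..<L}) \<subseteq> harmonic_zeros p (- q)"
    unfolding p_def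
  proof clarsimp
    fix j l assume "j < n div 2" "l < L"
    then show "\<zeta> (j, l) \<in> harmonic_zeros (monom (of_real \<epsilon>) n + q) (- q)"
      using s[of j l] n
      by (intro harmonic_zero_on_ray[of n _ "s j l" j]) (auto simp: \<zeta>_def h_def g_def)
  qed
  then have "card (\<zeta> ` ({..<n div 2} \<times> {..<L})) \<le> card (harmonic_zeros p (- q))"
    using harmonic_zeros_bound(1)[of p n "- q"] degp deg by (intro card_mono) auto
  also have "\<dots> \<le> max_zeros n (degree q)"
    using degp deg by (intro card_le_max_zeros) auto
  finally show ?thesis .
qed

section \<open>The imaginary part of a power of a linear polynomial along a ray\<close>

text \<open>
  The law of sines in the triangle with vertices \<open>0\<close>, \<open>1\<close> and \<open>z\<close>, whose angle at \<open>0\<close> is \<open>\<theta>\<close> and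
  whose angle at \<open>1\<close> is \<open>\<alpha>\<close>.
\<close>

lemma law_of_sines_complex:
  assumes "sin (\<alpha> + \<theta>) \<noteq> 0"
  shows "of_real (sin \<alpha> / sin (\<alpha> + \<theta>)) * cis \<theta> - 1 = of_real (- (sin \<theta> / sin (\<alpha> + \<theta>))) * cis (- \<alpha>)"
  using assms by (auto simp: complex_eq_iff field_simps sin_add)

lemma sine_quotient_strict_mono:
  fixes \<alpha> \<beta> \<theta> :: real
  assumes "0 < \<alpha>" "\<alpha> < \<beta>" "0 < \<theta>" "\<beta> + \<theta> < pi"
  shows "sin \<alpha> / sin (\<alpha> + \<theta>) < sin \<beta> / sin (\<beta> + \<theta>)"
proof -
  have "sin \<theta> > 0" "sin (\<beta> - \<alpha>) > 0" "sin (\<alpha> + \<theta>) > 0" "sin (\<beta> + \<theta>) > 0"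
    using assms by (auto intro!: sin_gt_zero)
  moreover have "sin \<beta> * sin (\<alpha> + \<theta>) - sin \<alpha> * sin (\<beta> + \<theta>) = sin \<theta> * sin (\<beta> - \<alpha>)"
    by (simp add: sin_add sin_diff algebra_simps)
  ultimately show ?thesis
    by (simp add: divide_less_eq less_divide_eq field_simps)
qed

text \<open>
  Here \<open>z - 1\<close> has argument \<open>\<pi> - \<alpha>\<close>, and \<open>m \<alpha>\<close> is an odd multiple of \<open>\<pi>/2\<close>.
\<close>

lemma Im_power_on_ray:
  fixes m l :: nat
  assumes "m > 0" and \<alpha>: "\<alpha> = ray_angle m l" and "sin (\<alpha> + \<theta>) \<noteq> 0"
  shows "Im ((of_real (sin \<alpha> / sin (\<alpha> + \<theta>)) * cis \<theta> - 1) ^ m)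
      = (-1) ^ Suc l * (- (sin \<theta> / sin (\<alpha> + \<theta>))) ^ m"
proof -
  have "cis (- \<alpha>) ^ m = cnj (cis \<alpha> ^ m)" by (simp add: cis_cnj)
  also have "\<dots> = of_real ((-1) ^ Suc l) * \<i>"
    using assms(1) by (simp add: \<alpha> cis_ray_angle_power)
  finally have cis: "cis (- \<alpha>) ^ m = of_real ((-1) ^ Suc l) * \<i>" .
  have "(of_real (sin \<alpha> / sin (\<alpha> + \<theta>)) * cis \<theta> - 1) ^ m
      = of_real ((- (sin \<theta> / sin (\<alpha> + \<theta>))) ^ m * (-1) ^ Suc l) * \<i>"
    by (simp only: law_of_sines_complex[OF assms(3)] power_mult_distrib cis of_real_mult
        of_real_power mult.assoc)
  then show ?thesis
    by (simp only: Im_complex_of_real Re_complex_of_real times_complex.sel imaginary_unit.sel) simp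
qed

text \<open>
  The angles \<open>\<alpha>\<close> at the vertex \<open>1\<close> are kept below \<open>\<pi>/2\<close>, by the condition \<open>l < m div 2\<close>, so that
  \<open>\<alpha> + \<theta> < \<pi>\<close>: then every ray of angle \<open>\<theta> \<le> \<pi>/2\<close> really meets the line that leaves \<open>1\<close> in the
  direction \<open>\<pi> - \<alpha>\<close>.
\<close>

lemma many_zeros:
  assumes "m \<ge> 2" "m < n"
  shows "(n div 2) * (m div 2 - 1) \<le> max_zeros n m"
proof -
  define q :: "complex poly" where "q = [:-1, 1:] ^ m"
  have q: "poly q z = (z - 1) ^ m" for z by (simp add: q_def)
  have deg: "degree q = m" by (simp add: q_def degree_linear_power)
  define \<rho> where "\<rho> = (\<lambda>j l. - (sin (ray_angle n j) / sin (ray_angle m l + ray_angle n j)))"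
  define R where "R = (\<lambda>j l. sin (ray_angle m l) / sin (ray_angle m l + ray_angle n j))"
  have less: "ray_angle m l < pi / 2" if "l < m div 2" for l
  proof -
    have "2 * l + 1 < m" using that by auto
    then have "2 * real l + 1 < real m" by linarith
    then have "pi * (2 * real l + 1) < pi * real m" by (intro mult_strict_left_mono) auto
    then show ?thesis using that by (simp add: ray_angle_def divide_less_eq)
  qed
  have sum: "0 < ray_angle m l" "0 < ray_angle n j" "ray_angle m l + ray_angle n j < pi"
    if "j < n div 2" "l < m div 2" for j l
    using ray_angle_bounds[OF that(1)] ray_angle_bounds[OF that(2)] less[OF that(2)] by auto
  have sin_pos: "sin (ray_angle m l) > 0" "sin (ray_angle n j) > 0"
      "sin (ray_angle m l + ray_angle n j) > 0"
    if "j < n div 2" "l < m div 2" for j l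
    using sum[OF that] by (auto intro!: sin_gt_zero)
  have Im: "Im (poly q (of_real (R j l) * cis (ray_angle n j))) = (-1) ^ Suc l * \<rho> j l ^ m"
    if "j < n div 2" "l < m div 2" for j l
    unfolding q R_def \<rho>_def
    by (rule Im_power_on_ray) (use assms sin_pos[OF that] in auto)
  have \<rho>: "\<rho> j l < 0" if "j < n div 2" "l < m div 2" for j l
    using sin_pos[OF that] by (simp add: \<rho>_def)
  define L where "L = m div 2 - 1"
  have L: "l < m div 2 \<longleftrightarrow> l \<le> L" for l using assms by (auto simp: L_def)
  have "(n div 2) * L \<le> max_zeros n (degree q)"
  proof (rule zeros_from_sign_changes[where R = R])
    fix j l assume "j < n div 2" "l \<le> L"
    then show "0 < R j l" "Im (poly q (of_real (R j l) * cis (ray_angle n j))) \<noteq> 0"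
      using sin_pos[of j l] Im[of j l] \<rho>[of j l] by (auto simp: R_def L)
  next
    fix j l l' assume "j < n div 2" "l < l'" "l' \<le> L"
    moreover from this have "ray_angle m l < ray_angle m l'"
      using assms by (simp add: ray_angle_def divide_strict_right_mono)
    ultimately show "R j l < R j l'"
      unfolding R_def using sum[of j l] sum[of j l']
      by (intro sine_quotient_strict_mono) (auto simp: L)
  next
    fix j l assume jl: "j < n div 2" "l < L"
    then have "\<rho> j l * \<rho> j (Suc l) > 0"
      using \<rho>[of j l] \<rho>[of j "Suc l"] by (auto simp: L zero_less_mult_iff)
    then have "(\<rho> j l * \<rho> j (Suc l)) ^ m > 0" by simp
    moreover have "((-1) ^ Suc l * \<rho> j l ^ m) * ((-1) ^ Suc (Suc l) * \<rho> j (Suc l) ^ m)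
        = - ((\<rho> j l * \<rho> j (Suc l)) ^ m)"
      by (simp add: power_mult_distrib flip: power_add mult.assoc)
    ultimately show "Im (poly q (of_real (R j l) * cis (ray_angle n j)))
        * Im (poly q (of_real (R j (Suc l)) * cis (ray_angle n j))) < 0"
      using jl by (simp add: Im L)
  qed (use assms deg in auto)
  then show ?thesis by (simp add: deg L_def)
qed

section \<open>The iterated upper limit\<close>

lemma limsup_max_zeros_ge:
  assumes "m \<ge> 2"
  shows "ereal ((real m - 3) / 8) \<le> limsup (\<lambda>n. ereal (real (max_zeros n m) / real n))"
proof (rule le_Limsup)
  show "\<forall>\<^sub>F n in sequentially. ereal ((real m - 3) / 8) \<le> ereal (real (max_zeros n m) / real n)"
    using eventually_gt_at_top[of m]
  proof eventually_elim
    case (elim n)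
    define k where "k = m div 2 - 1"
    have "m \<le> 2 * k + 3" "n \<le> 4 * (n div 2)"
      using elim assms unfolding k_def by linarith+
    then have "real m \<le> real (2 * k + 3)" "real n \<le> real (4 * (n div 2))"
      by (simp_all only: of_nat_le_iff)
    then have k: "(real m - 3) / 2 \<le> real k" "real n / 4 \<le> real (n div 2)"
      by (simp_all add: field_simps)
    have "(real m - 3) / 2 * (real n / 4) \<le> real k * real (n div 2)"
    proof (cases "m \<ge> 3")
      case True
      then show ?thesis
        using k by (intro mult_mono) auto
    next
      case False
      then have "(real m - 3) / 2 * (real n / 4) \<le> 0"
        by (intro mult_nonpos_nonneg) auto
      also have "0 \<le> real k * real (n div 2)" by simp
      finally show ?thesis .
    qed
    also have "\<dots> = real ((n div 2) * (m div 2 - 1))" by (simp add: k_def)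
    also have "\<dots> \<le> real (max_zeros n m)"
      using many_zeros[OF assms elim] by (simp only: of_nat_le_iff)
    finally show ?case using elim by (simp add: field_simps)
  qed
qed simp

theorem mainTheorem2:
  "limsup (\<lambda>m. limsup (\<lambda>n. ereal (real (max_zeros n m) / real n))) = \<infinity>"
proof (rule ereal_top)
  fix B :: real
  show "ereal B \<le> limsup (\<lambda>m. limsup (\<lambda>n. ereal (real (max_zeros n m) / real n)))"
  proof (rule le_Limsup)
    show "\<forall>\<^sub>F m in sequentially. ereal B \<le> limsup (\<lambda>n. ereal (real (max_zeros n m) / real n))"
      using eventually_ge_at_top[of "max 2 (nat \<lceil>8 * B + 3\<rceil>)"]
    proof eventually_elim
      case (elim m)
      then have "ereal B \<le> ereal ((real m - 3) / 8)" by simp linarith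
      also have "\<dots> \<le> limsup (\<lambda>n. ereal (real (max_zeros n m) / real n))"
        using elim by (intro limsup_max_zeros_ge) simp
      finally show ?case .
    qed
  qed simp
qed

end
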